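(* Let $n=2p+1\geq 3$ be odd and let $G$ be a connected bipartite graph on $n$ vertices that has no suspended paths. Then $RE(G)\leq RE(S^p)$, where $S^p$ is the $p$-sun.
   Context: Graphs are finite, simple and undirected. For a graph $G$ with vertex set $V$, edge set $E$ and vertex degrees $d_u$, the Randić matrix $R=[r_{uv}]$ is the real symmetric matrix indexed by $V$ with $r_{uv}=1/\sqrt{d_ud_v}$ if $uv\in E$ and $r_{uv}=0$ otherwise. The Randić energy is $RE(G)=\sum_{i=1}^n|\lambda_i|$, where $\lambda_1,\dots,\lambda_n$ are the eigenvalues of $R$ with multiplicity. A suspended path is a path $uvw$ in $G$ with $d_u=1$ and $d_v=2$ (i.e. $u$ is a pendent vertex whose neighbor has degree $2$). The $p$-sun $S^p$ is the tree of order $2p+1$ obtained from the star on $p+1$ vertices (one center joined to $p$ leaves) by subdividing each edge once. *)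

theory Defs
  imports
    "Graph_Theory.Digraph_Component"
    "Graph_Theory.Vertex_Walk"
    "Jordan_Normal_Form.Char_Poly"
begin

text \<open>
  A finite simple undirected graph is a \<^locale>\<open>pair_graph\<close>: a finite loop-free digraph without
  parallel arcs whose arc relation is symmetric, so that an edge $uv$ is the pair of arcs
  $(u,v)$, $(v,u)$ and the degree of a vertex is its out-degree.
\<close>

abbreviation vdeg :: "'a pair_pre_digraph \<Rightarrow> 'a \<Rightarrow> nat" where
  "vdeg G v \<equiv> out_degree (with_proj G) v"

definition bipartite :: "'a pair_pre_digraph \<Rightarrow> bool" where
  "bipartite G \<longleftrightarrow> (\<exists>U W. pverts G = U \<union> W \<and> U \<inter> W = {} \<and> parcs G \<subseteq> U \<times> W \<union> W \<times> U)"

definition suspended_path :: "'a pair_pre_digraph \<Rightarrow> 'a \<Rightarrow> 'a \<Rightarrow> 'a \<Rightarrow> bool" where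
  "suspended_path G u v w \<longleftrightarrow> vpath [u, v, w] (with_proj G) \<and> vdeg G u = 1 \<and> vdeg G v = 2"

definition randic_entry :: "'a pair_pre_digraph \<Rightarrow> 'a \<Rightarrow> 'a \<Rightarrow> real" where
  "randic_entry G u v =
    (if (u, v) \<in> parcs G then 1 / sqrt (real (vdeg G u) * real (vdeg G v)) else 0)"

definition randic_mat_wrt :: "'a list \<Rightarrow> 'a pair_pre_digraph \<Rightarrow> real mat" where
  "randic_mat_wrt vs G =
    mat (length vs) (length vs) (\<lambda>(i, j). randic_entry G (vs ! i) (vs ! j))"

text \<open>
  Matrices are indexed by initial segments of the naturals, so the Randic matrix is taken with
  respect to some enumeration of the vertices; by \<open>randic_energy_eq\<close> below the energy does not
  depend on it.
\<close>

definition randic_mat :: "'a pair_pre_digraph \<Rightarrow> real mat" where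
  "randic_mat G = randic_mat_wrt (SOME vs. distinct vs \<and> set vs = pverts G) G"

text \<open>
  The multiset \<^term>\<open>proots (char_poly A)\<close> contains each real eigenvalue with its algebraic
  multiplicity; for a symmetric matrix these are all the eigenvalues.
\<close>

definition randic_energy :: "'a pair_pre_digraph \<Rightarrow> real" where
  "randic_energy G = (\<Sum>x\<in>#proots (char_poly (randic_mat G)). \<bar>x\<bar>)"

definition star_graph :: "nat \<Rightarrow> nat pair_pre_digraph" where
  "star_graph p = \<lparr>pverts = {0..p}, parcs = {0} \<times> {1..p} \<union> {1..p} \<times> {0}\<rparr>"

text \<open>
  Subdividing every edge once: the new vertex on the edge $uv$ is \<^term>\<open>Inr {u, v}\<close>. Symmetry of
  \<^term>\<open>parcs G\<close> makes it adjacent to both end points.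
\<close>

definition subdivide_edges :: "'a pair_pre_digraph \<Rightarrow> ('a + 'a set) pair_pre_digraph" where
  "subdivide_edges G =
    \<lparr>pverts = pverts G <+> {{u, v} | u v. (u, v) \<in> parcs G},
     parcs = {(Inl u, Inr {u, v}) | u v. (u, v) \<in> parcs G}
           \<union> {(Inr {u, v}, Inl u) | u v. (u, v) \<in> parcs G}\<rparr>"

definition sun :: "nat \<Rightarrow> (nat + nat set) pair_pre_digraph" where
  "sun p = subdivide_edges (star_graph p)"


lemma pair_graph_star_graph: "pair_graph (star_graph p)"
  by unfold_locales (auto simp: star_graph_def symmetric_def intro: symI)

lemma pair_graph_subdivide_edges:
  assumes "pair_graph G"
  shows "pair_graph (subdivide_edges G)"
proof -
  interpret pair_graph G by fact
  have 1: "finite {{u, v} | u v. (u, v) \<in> parcs G}"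
  proof -
    have "{{u, v} | u v. (u, v) \<in> parcs G} = (\<lambda>(u, v). {u, v}) ` parcs G" by auto
    then show ?thesis using pair_finite_arcs by simp
  qed
  have 2: "{(Inl u, Inr {u, v}) | u v. (u, v) \<in> parcs G} = (\<lambda>(u, v). (Inl u, Inr {u, v})) ` parcs G"
    "{(Inr {u, v}, Inl u) | u v. (u, v) \<in> parcs G} = (\<lambda>(u, v). (Inr {u, v}, Inl u)) ` parcs G"
    by auto
  have 3: "finite (parcs (subdivide_edges G))"
    unfolding subdivide_edges_def using pair_finite_arcs by (simp add: 2)
  show ?thesis
  proof unfold_locales
    fix e assume e: "e \<in> parcs (subdivide_edges G)"
    then obtain u v where uv: "(u, v) \<in> parcs G"
      and "e = (Inl u, Inr {u, v}) \<or> e = (Inr {u, v}, Inl u)"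
      by (auto simp: subdivide_edges_def)
    moreover have "Inl u \<in> pverts (subdivide_edges G)"
      using in_arcsD1[OF uv] by (simp add: subdivide_edges_def InlI)
    moreover have "Inr {u, v} \<in> pverts (subdivide_edges G)"
      using uv unfolding subdivide_edges_def by (auto intro!: InrI)
    ultimately show "fst e \<in> pverts (subdivide_edges G)" "snd e \<in> pverts (subdivide_edges G)"
      "fst e \<noteq> snd e"
      by auto
  next
    show "finite (pverts (subdivide_edges G))"
      using 1 pair_finite_verts by (simp add: subdivide_edges_def)
    show "finite (parcs (subdivide_edges G))" by (rule 3)
    show "Digraph.symmetric (with_proj (subdivide_edges G))"
      unfolding symmetric_def with_proj_simps
      by (rule symI) (auto simp: subdivide_edges_def)
  qed
qed

lemma pair_graph_sun: "pair_graph (sun p)"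
  unfolding sun_def by (intro pair_graph_subdivide_edges pair_graph_star_graph)

lemma card_sun: "card (pverts (sun p)) = 2 * p + 1"
proof -
  have "{{u, v} | u v. (u, v) \<in> parcs (star_graph p)} = (\<lambda>i. {0, i}) ` {1..p}"
  proof (intro equalityI subsetI)
    fix e assume "e \<in> {{u, v} | u v. (u, v) \<in> parcs (star_graph p)}"
    then show "e \<in> (\<lambda>i. {0, i}) ` {1..p}" by (auto simp: star_graph_def insert_commute)
  next
    fix e assume "e \<in> (\<lambda>i. {0, i}) ` {1..p}"
    then obtain i where "e = {0, i}" "(0, i) \<in> parcs (star_graph p)" by (auto simp: star_graph_def)
    then show "e \<in> {{u, v} | u v. (u, v) \<in> parcs (star_graph p)}" by blast
  qed
  moreover have "inj_on (\<lambda>i::nat. {0, i}) {1..p}"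
    by (auto simp: inj_on_def doubleton_eq_iff)
  ultimately have "card {{u, v} | u v. (u, v) \<in> parcs (star_graph p)} = p"
    "finite {{u, v} | u v. (u, v) \<in> parcs (star_graph p)}"
    by (simp_all add: card_image)
  then show ?thesis
    unfolding sun_def subdivide_edges_def
    by (simp only: pair_pre_digraph.simps, subst card_Plus) (simp_all add: star_graph_def)
qed

lemma char_poly_randic_mat_wrt:
  assumes "distinct vs" "distinct ws" "set vs = set ws"
  shows "char_poly (randic_mat_wrt vs G) = char_poly (randic_mat_wrt ws G)"
proof -
  define n where "n = length vs"
  have len: "length ws = n"
    using assms by (metis distinct_card n_def)
  define f where "f = (\<lambda>i. if i < n then (THE j. j < n \<and> ws ! j = vs ! i) else i)"
  have ex1: "\<exists>!j. j < n \<and> ws ! j = vs ! i" if "i < n" for i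
    using that assms len n_def by (metis distinct_Ex1 nth_mem)
  have f: "f i < n" "ws ! f i = vs ! i" if "i < n" for i
    using theI'[OF ex1[OF that]] that by (auto simp: f_def)
  have inj: "inj_on f {0..<n}"
    by (rule inj_onI) (metis assms(1) atLeastLessThan_iff f(2) n_def nth_eq_iff_index_eq)
  have "f ` {0..<n} = {0..<n}"
    using f(1) by (intro endo_inj_surj inj) auto
  then have perm: "f permutes {0..<n}"
    using inj by (intro bij_imp_permutes) (auto simp: bij_betw_def f_def)
  let ?B = "randic_mat_wrt ws G"
  let ?M = "char_poly_matrix ?B"
  have B: "?B \<in> carrier_mat n n" by (simp add: randic_mat_wrt_def len)
  then have M: "?M \<in> carrier_mat n n" by simp
  let ?C = "mat n n (\<lambda>(i, j). ?M\<^sup>T $$ (f i, j))"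
  have C: "?C\<^sup>T \<in> carrier_mat n n" and MT: "?M\<^sup>T \<in> carrier_mat n n" using M by auto
  have "char_poly_matrix (randic_mat_wrt vs G) = mat n n (\<lambda>(i, j). ?C\<^sup>T $$ (f i, j))"
  proof (rule eq_matI)
    fix i j
    assume "i < dim_row (mat n n (\<lambda>(i, j). ?C\<^sup>T $$ (f i, j)))"
      and "j < dim_col (mat n n (\<lambda>(i, j). ?C\<^sup>T $$ (f i, j)))"
    then have i: "i < n" and j: "j < n" by simp_all
    have "f i = f j \<longleftrightarrow> i = j"
      using inj i j by (auto simp: inj_on_eq_iff)
    moreover have "mat n n (\<lambda>(i, j). ?C\<^sup>T $$ (f i, j)) $$ (i, j) = ?M $$ (f i, f j)"
      using i j f(1)[OF i] f(1)[OF j] M by simp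
    ultimately show "char_poly_matrix (randic_mat_wrt vs G) $$ (i, j) =
        mat n n (\<lambda>(i, j). ?C\<^sup>T $$ (f i, j)) $$ (i, j)"
      using i j f(1)[OF i] f(1)[OF j] f(2)[OF i] f(2)[OF j]
      by (simp add: char_poly_matrix_def randic_mat_wrt_def len n_def[symmetric])
  qed (simp_all add: char_poly_matrix_def randic_mat_wrt_def n_def)
  also have "det \<dots> = signof f * det (?C\<^sup>T)"
    by (rule det_permute_rows[OF C perm])
  also have "det (?C\<^sup>T) = signof f * det ?M"
    using det_transpose[of ?C n] det_permute_rows[OF MT perm] det_transpose[OF M] by simp
  also have "signof f * (signof f * det ?M) = det ?M"
    by (simp add: sign_def)
  finally show ?thesis by (simp add: char_poly_def)
qed

lemma randic_energy_eq:
  assumes "distinct vs" "set vs = pverts G"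
  shows "randic_energy G = (\<Sum>x\<in>#proots (char_poly (randic_mat_wrt vs G)). \<bar>x\<bar>)"
proof -
  let ?ws = "SOME vs. distinct vs \<and> set vs = pverts G"
  have "distinct ?ws \<and> set ?ws = pverts G"
    by (rule someI[of _ vs]) (use assms in simp)
  then have "char_poly (randic_mat G) = char_poly (randic_mat_wrt vs G)"
    unfolding randic_mat_def using assms by (intro char_poly_randic_mat_wrt) auto
  then show ?thesis by (simp add: randic_energy_def)
qed

end

theory Submission
  imports Defs "Jordan_Normal_Form.Schur_Decomposition"
begin

text \<open>
  Let $R$ be the Randic matrix of $G$. Its trace norm is bounded through the trace of $R^2$, which
  is the sum of $\frac{1}{d_u d_v}$ over all arcs. If $G$ is connected with at least three vertices,
  having no suspended path means precisely that $d_u + d_v \ge 4$ for every edge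
  (\<open>vdeg_sum_ge_4\<close>, which is the direction used), so
  $\frac{1}{d_u d_v} \le \frac{1}{4 d_u} + \frac{1}{4 d_v}$ and the trace of $R^2$ is at most
  $n / 2 = p + \frac12$ (\<open>sum_square_randic_entry_le\<close>).

  A connected bipartite graph has the eigenvalues $1$ and $-1$, and $0$ as well if its order is odd
  (\<open>one_in_randic_spectrum\<close>, \<open>zero_in_randic_spectrum\<close>). For the remaining $2p - 2$ eigenvalues
  the sum of the squares is therefore at most $p - 1$, and
  $|x| \le (x^2 + \frac12) / \sqrt 2$ bounds the sum of their absolute values by
  $\sqrt 2 (p - 1)$. Hence the energy is at most $2 + \sqrt 2 (p - 1)$ (\<open>randic_energy_le\<close>).

  The sun attains this value (\<open>randic_energy_sun\<close>). An eigenvector computation shows that its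
  eigenvalues lie in $\{0, \pm 1, \pm \frac{1}{\sqrt 2}\}$. On this set $|x|$ is a combination of $x^2$
  and $x^4$, so the energy is a combination of the traces of $R^2$ and $R^4$.

  The link between traces and eigenvalues is that a real symmetric matrix has a real spectrum whose
  power sums are the traces of the powers of the matrix
  (\<open>symmetric_char_poly_splits\<close>, \<open>eigenvalue_power_sum\<close>).
\<close>

section \<open>Eigenvalues of real symmetric matrices\<close>

text \<open>
  If $Av = zv$, the number $v^* A v = z \|v\|^2$ equals its own conjugate because $A$ is real
  symmetric, and $\|v\|^2 \neq 0$.
\<close>

lemma symmetric_eigenvalue_real:
  fixes A :: "real mat" and z :: complex
  assumes A: "A \<in> carrier_mat n n"
    and sym: "\<And>i j. i < n \<Longrightarrow> j < n \<Longrightarrow> A $$ (i, j) = A $$ (j, i)"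
    and ev: "eigenvalue (map_mat complex_of_real A) z"
  shows "Im z = 0"
proof -
  let ?A = "map_mat complex_of_real A"
  obtain v where "eigenvector ?A v z"
    using ev by (auto simp: eigenvalue_def)
  then have v: "v \<in> carrier_vec n" and nz: "v \<noteq> 0\<^sub>v n" and eq: "?A *\<^sub>v v = z \<cdot>\<^sub>v v"
    using A by (auto simp: eigenvector_def)
  have row: "(\<Sum>j<n. complex_of_real (A $$ (i, j)) * v $ j) = z * v $ i" if "i < n" for i
  proof -
    have "(?A *\<^sub>v v) $ i = (\<Sum>j<n. complex_of_real (A $$ (i, j)) * v $ j)"
      using A v that by (simp add: scalar_prod_def lessThan_atLeast0)
    then show ?thesis using eq v that by simp
  qed
  define q where "q = (\<Sum>i<n. \<Sum>j<n. cnj (v $ i) * complex_of_real (A $$ (i, j)) * v $ j)"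
  define N where "N = (\<Sum>i<n. (cmod (v $ i))\<^sup>2)"
  have q: "q = z * complex_of_real N"
  proof -
    have "q = (\<Sum>i<n. cnj (v $ i) * (z * v $ i))"
      unfolding q_def by (intro sum.cong refl) (simp add: row[symmetric] sum_distrib_left mult.assoc)
    also have "\<dots> = z * complex_of_real N"
      unfolding N_def of_real_sum sum_distrib_left
      by (intro sum.cong refl) (simp add: complex_norm_square[symmetric] mult_ac flip: of_real_power)
    finally show ?thesis .
  qed
  have "cnj q = (\<Sum>i<n. \<Sum>j<n. cnj (v $ j) * complex_of_real (A $$ (j, i)) * v $ i)"
    unfolding q_def cnj_sum by (intro sum.cong refl) (simp add: sym mult_ac)
  also have "\<dots> = q"
    unfolding q_def by (rule sum.swap)
  finally have "Im q = 0" by (simp add: complex_eq_iff)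
  moreover have "N \<noteq> 0"
  proof
    assume "N = 0"
    then have "\<forall>i<n. v $ i = 0" by (simp add: N_def sum_nonneg_eq_0_iff)
    then show False using v nz by (auto intro!: eq_vecI)
  qed
  ultimately show ?thesis by (simp add: q)
qed

text \<open>
  The complex roots are eigenvalues, hence real, so the factorization over the complex numbers
  descends along the injection of real into complex polynomials.
\<close>

lemma symmetric_char_poly_splits:
  fixes A :: "real mat"
  assumes A: "A \<in> carrier_mat n n"
    and sym: "\<And>i j. i < n \<Longrightarrow> j < n \<Longrightarrow> A $$ (i, j) = A $$ (j, i)"
  obtains es where "char_poly A = (\<Prod>e\<leftarrow>es. [:- e, 1:])" "length es = n"
proof -
  interpret poly_of_real: map_poly_inj_idom_hom complex_of_real ..
  let ?A = "map_mat complex_of_real A"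
  have cA: "?A \<in> carrier_mat n n" using A by simp
  obtain zs where zs: "char_poly ?A = (\<Prod>z\<leftarrow>zs. [:- z, 1:])" and len: "length zs = n"
    using char_poly_factorized[OF cA] by blast
  have real: "complex_of_real (Re z) = z" if "z \<in> set zs" for z
  proof -
    have "poly (char_poly ?A) z = 0"
      unfolding zs poly_prod_list using that by (force simp: prod_list_zero_iff)
    then have "Im z = 0"
      using symmetric_eigenvalue_real[OF A sym] eigenvalue_root_char_poly[OF cA] by blast
    then show ?thesis by (simp add: complex_eq_iff)
  qed
  have "map_poly complex_of_real (char_poly A) = (\<Prod>z\<leftarrow>zs. [:- z, 1:])"
    unfolding zs[symmetric] by (rule of_real_hom.char_poly_hom[OF A, symmetric])
  also have "\<dots> = map_poly complex_of_real (\<Prod>e\<leftarrow>map Re zs. [:- e, 1:])"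
    using real by (induction zs) (simp_all add: poly_of_real.hom_mult map_poly_pCons o_def del: mult_pCons_left)
  finally have "char_poly A = (\<Prod>e\<leftarrow>map Re zs. [:- e, 1:])"
    by simp
  with len show ?thesis by (intro that[of "map Re zs"]) simp_all
qed

lemma upper_triangular_pow:
  fixes B :: "'a :: comm_semiring_1 mat"
  assumes B: "B \<in> carrier_mat n n" and ut: "upper_triangular B"
  shows "upper_triangular (B ^\<^sub>m k)" and "i < n \<Longrightarrow> (B ^\<^sub>m k) $$ (i, i) = (B $$ (i, i)) ^ k"
proof -
  have "(\<forall>i<n. \<forall>j<i. (B ^\<^sub>m k) $$ (i, j) = 0) \<and> (\<forall>i<n. (B ^\<^sub>m k) $$ (i, i) = (B $$ (i, i)) ^ k)"
  proof (induction k)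
    case (Suc k)
    have Bk: "B ^\<^sub>m k \<in> carrier_mat n n" using B by simp
    have entry: "(B ^\<^sub>m Suc k) $$ (i, j) = (\<Sum>l<n. (B ^\<^sub>m k) $$ (i, l) * B $$ (l, j))"
      if "i < n" "j < n" for i j
      using that B Bk by (simp add: scalar_prod_def lessThan_atLeast0)
    have low: "B $$ (l, j) = 0" if "l < n" "j < l" for l j
      using that ut B by (auto simp: upper_triangular_def)
    have "(B ^\<^sub>m Suc k) $$ (i, j) = 0" if "i < n" "j < i" for i j
    proof -
      have "(B ^\<^sub>m k) $$ (i, l) * B $$ (l, j) = 0" if "l < n" for l
        using Suc low[of l j] that \<open>i < n\<close> \<open>j < i\<close> by (cases "l < i") auto
      then show ?thesis using entry[of i j] that by simp
    qed
    moreover have "(B ^\<^sub>m Suc k) $$ (i, i) = (B $$ (i, i)) ^ Suc k" if "i < n" for i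
    proof -
      have "(B ^\<^sub>m k) $$ (i, l) * B $$ (l, i) = (if l = i then (B $$ (i, i)) ^ Suc k else 0)"
        if "l < n" for l
        using Suc low[of l i] that \<open>i < n\<close> by (cases "l < i"; cases "l = i") (auto simp: mult.commute)
      then have "(\<Sum>l<n. (B ^\<^sub>m k) $$ (i, l) * B $$ (l, i)) =
          (\<Sum>l<n. if l = i then (B $$ (i, i)) ^ Suc k else 0)"
        by (intro sum.cong) auto
      then show ?thesis using entry[of i i] that by simp
    qed
    ultimately show ?case by blast
  qed (use B in auto)
  then show "upper_triangular (B ^\<^sub>m k)" and "i < n \<Longrightarrow> (B ^\<^sub>m k) $$ (i, i) = (B $$ (i, i)) ^ k"
    using B by (auto simp: upper_triangular_def)
qed

lemma trace_similar:
  fixes A :: "'a :: comm_semiring_1 mat"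
  assumes "A \<in> carrier_mat n n" and "similar_mat_wit A B P Q"
  shows "(\<Sum>i<n. A $$ (i, i)) = (\<Sum>i<n. B $$ (i, i))"
proof -
  note wit = similar_mat_witD2[OF assms]
  have B: "B \<in> carrier_mat n n" and P: "P \<in> carrier_mat n n" and Q: "Q \<in> carrier_mat n n"
    and QP: "Q * P = 1\<^sub>m n" and AB: "A = P * B * Q"
    using wit by auto
  have QPe: "(\<Sum>i<n. Q $$ (b, i) * P $$ (i, a)) = (if b = a then 1 else 0)"
    if "a < n" "b < n" for a b
  proof -
    have "(Q * P) $$ (b, a) = (\<Sum>i<n. Q $$ (b, i) * P $$ (i, a))"
      using that P Q by (simp add: scalar_prod_def lessThan_atLeast0)
    then show ?thesis using that unfolding QP by simp
  qed
  have "(\<Sum>i<n. A $$ (i, i)) = (\<Sum>i<n. \<Sum>b<n. (\<Sum>a<n. P $$ (i, a) * B $$ (a, b)) * Q $$ (b, i))"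
    unfolding AB using P Q B by (intro sum.cong) (auto simp: scalar_prod_def lessThan_atLeast0 simp del: assoc_mult_mat)
  also have "\<dots> = (\<Sum>i<n. \<Sum>b<n. \<Sum>a<n. B $$ (a, b) * (Q $$ (b, i) * P $$ (i, a)))"
    by (simp add: sum_distrib_left sum_distrib_right mult_ac)
  also have "\<dots> = (\<Sum>b<n. \<Sum>i<n. \<Sum>a<n. B $$ (a, b) * (Q $$ (b, i) * P $$ (i, a)))"
    by (rule sum.swap)
  also have "\<dots> = (\<Sum>b<n. \<Sum>a<n. B $$ (a, b) * (\<Sum>i<n. Q $$ (b, i) * P $$ (i, a)))"
    unfolding sum_distrib_left by (intro sum.cong refl sum.swap)
  also have "\<dots> = (\<Sum>b<n. \<Sum>a<n. if b = a then B $$ (a, b) else 0)"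
    by (intro sum.cong refl) (simp add: QPe)
  also have "\<dots> = (\<Sum>b<n. B $$ (b, b))"
    by simp
  finally show ?thesis .
qed

text \<open>
  By Schur triangularization, since the trace is invariant under similarity and the $k$-th power of
  a triangular matrix carries the $k$-th powers on its diagonal. These power sums are what gives
  access to the spectrum in terms of the entries of $A$.
\<close>

lemma eigenvalue_power_sum:
  fixes A :: "real mat"
  assumes A: "A \<in> carrier_mat n n" and es: "char_poly A = (\<Prod>e\<leftarrow>es. [:- e, 1:])"
  shows "(\<Sum>e\<leftarrow>es. e ^ k) = (\<Sum>i<n. (A ^\<^sub>m k) $$ (i, i))"
proof -
  obtain B P Q where BPQ: "schur_decomposition A es = (B, P, Q)"
    by (cases "schur_decomposition A es") auto
  have sim: "similar_mat_wit A B P Q" and ut: "upper_triangular B" and diag: "diag_mat B = es"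
    using schur_decomposition[OF A es BPQ] by auto
  have B: "B \<in> carrier_mat n n" using similar_mat_witD2[OF A sim] by auto
  have "(\<Sum>i<n. (A ^\<^sub>m k) $$ (i, i)) = (\<Sum>i<n. (B ^\<^sub>m k) $$ (i, i))"
    using A by (intro trace_similar[OF _ similar_mat_wit_pow[OF sim]]) simp
  also have "\<dots> = (\<Sum>i<n. (B $$ (i, i)) ^ k)"
    by (intro sum.cong) (auto simp: upper_triangular_pow(2)[OF B ut])
  also have "\<dots> = (\<Sum>e\<leftarrow>es. e ^ k)"
    using B unfolding diag[symmetric] diag_mat_def
    by (simp add: o_def interv_sum_list_conv_sum_set_nat lessThan_atLeast0)
  finally show ?thesis by simp
qed

section \<open>The spectrum of the Randic matrix\<close>

definition randic_spectrum :: "'a pair_pre_digraph \<Rightarrow> real multiset" where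
  "randic_spectrum G = proots (char_poly (randic_mat G))"

lemma randic_energy_spectrum: "randic_energy G = (\<Sum>x\<in>#randic_spectrum G. \<bar>x\<bar>)"
  by (simp add: randic_energy_def randic_spectrum_def)

lemma randic_mat_wrt_carrier: "randic_mat_wrt vs G \<in> carrier_mat (length vs) (length vs)"
  by (simp add: randic_mat_wrt_def)

lemma randic_mat_wrt_index:
  "i < length vs \<Longrightarrow> j < length vs \<Longrightarrow> randic_mat_wrt vs G $$ (i, j) = randic_entry G (vs ! i) (vs ! j)"
  by (simp add: randic_mat_wrt_def)

lemma sum_nth:
  fixes h :: "'b \<Rightarrow> 'c :: comm_monoid_add"
  assumes "distinct vs"
  shows "(\<Sum>i<length vs. h (vs ! i)) = sum h (set vs)"
  by (rule sum.reindex_bij_betw[OF bij_betw_nth[OF assms refl refl]])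

context pair_graph
begin

lemma vdeg_eq: "vdeg G u = card {v. (u, v) \<in> parcs G}"
proof -
  have "out_arcs (with_proj G) u = Pair u ` {v. (u, v) \<in> parcs G}"
    by (auto simp: out_arcs_def)
  then show ?thesis by (simp add: out_degree_def card_image inj_on_def)
qed

lemma arc_sym: "(u, v) \<in> parcs G \<longleftrightarrow> (v, u) \<in> parcs G"
  using sym_arcs unfolding symmetric_def by (auto dest: symD)

lemma finite_neighbours: "finite {v. (u, v) \<in> parcs G}"
  by (rule finite_subset[OF _ pair_finite_verts]) (auto dest: in_arcsD2)

lemma vdeg_pos: "(u, v) \<in> parcs G \<Longrightarrow> 0 < vdeg G u"
  unfolding vdeg_eq by (subst card_gt_0_iff) (auto simp: finite_neighbours)

lemma sum_neighbours:
  fixes h :: "'a \<Rightarrow> 'b :: comm_monoid_add"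
  shows "(\<Sum>v\<in>pverts G. if (u, v) \<in> parcs G then h v else 0) = (\<Sum>v | (u, v) \<in> parcs G. h v)"
proof -
  have "pverts G \<inter> {v. (u, v) \<in> parcs G} = {v. (u, v) \<in> parcs G}"
    by (auto dest: in_arcsD2)
  then show ?thesis using sum.inter_restrict[OF pair_finite_verts, of h "{v. (u, v) \<in> parcs G}"] by simp
qed

lemma randic_entry_sym: "randic_entry G u v = randic_entry G v u"
  by (simp add: randic_entry_def arc_sym mult.commute)

lemma randic_mat_obtain:
  obtains vs where "randic_mat G = randic_mat_wrt vs G" "distinct vs" "set vs = pverts G"
    "length vs = card (pverts G)"
proof -
  define vs where "vs = (SOME vs. distinct vs \<and> set vs = pverts G)"
  obtain ws where "distinct ws \<and> set ws = pverts G"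
    using finite_distinct_list[OF pair_finite_verts] by auto
  then have "distinct vs \<and> set vs = pverts G"
    unfolding vs_def by (rule someI)
  with that[of vs] show ?thesis
    by (simp add: randic_mat_def vs_def distinct_card[symmetric])
qed

lemma randic_spectrum_eq_mset:
  obtains es where "char_poly (randic_mat G) = (\<Prod>e\<leftarrow>es. [:- e, 1:])"
    and "randic_spectrum G = mset es" and "length es = card (pverts G)"
proof -
  obtain vs where vs: "randic_mat G = randic_mat_wrt vs G" "length vs = card (pverts G)"
    using randic_mat_obtain by metis
  obtain es where es: "char_poly (randic_mat G) = (\<Prod>e\<leftarrow>es. [:- e, 1:])"
      "length es = card (pverts G)"
    unfolding vs(1)
    by (rule symmetric_char_poly_splits[OF randic_mat_wrt_carrier, of vs])
      (auto simp: randic_mat_wrt_index randic_entry_sym vs(2))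
  have "randic_spectrum G = mset es"
    unfolding randic_spectrum_def es(1)
    by (induction es) (simp_all add: proots_mult prod_list_zero_iff image_iff del: mult_pCons_left)
  with es that show ?thesis by blast
qed

lemma size_randic_spectrum: "size (randic_spectrum G) = card (pverts G)"
  by (rule randic_spectrum_eq_mset) simp

lemma randic_spectrum_power_sum:
  obtains vs where "distinct vs" "set vs = pverts G" 
    "\<And>k. (\<Sum>x\<in>#randic_spectrum G. x ^ k) = (\<Sum>i<length vs. (randic_mat_wrt vs G ^\<^sub>m k) $$ (i, i))"
proof -
  obtain vs where vs: "randic_mat G = randic_mat_wrt vs G" "distinct vs" "set vs = pverts G"
    by (rule randic_mat_obtain)
  obtain es where es: "char_poly (randic_mat G) = (\<Prod>e\<leftarrow>es. [:- e, 1:])"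
    "randic_spectrum G = mset es" by (rule randic_spectrum_eq_mset)
  show ?thesis
    using eigenvalue_power_sum[OF randic_mat_wrt_carrier es(1)[unfolded vs(1)]] vs es(2)
    by (intro that[of vs]) (auto simp flip: sum_mset_sum_list)
qed

lemma randic_mat_wrt_square_index:
  assumes "distinct vs" "set vs = pverts G" "i < length vs" "j < length vs"
  shows "(randic_mat_wrt vs G ^\<^sub>m 2) $$ (i, j) =
    (\<Sum>w\<in>pverts G. randic_entry G (vs ! i) w * randic_entry G w (vs ! j))"
  using assms(3,4) sum_nth[OF assms(1), of "\<lambda>w. randic_entry G (vs ! i) w * randic_entry G w (vs ! j)"]
  by (simp add: numeral_2_eq_2 randic_mat_wrt_def scalar_prod_def lessThan_atLeast0 assms(2))

text \<open>
  The trace of $R^2$: symmetry of $R$ turns it into the sum of the squared entries.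
\<close>

lemma sum_randic_spectrum_square:
  "(\<Sum>x\<in>#randic_spectrum G. x\<^sup>2) = (\<Sum>u\<in>pverts G. \<Sum>v\<in>pverts G. (randic_entry G u v)\<^sup>2)"
proof (rule randic_spectrum_power_sum)
  fix vs assume vs: "distinct vs" "set vs = pverts G"
    and eq: "\<And>k. (\<Sum>x\<in>#randic_spectrum G. x ^ k) =
      (\<Sum>i<length vs. (randic_mat_wrt vs G ^\<^sub>m k) $$ (i, i))"
  have "(\<Sum>i<length vs. (randic_mat_wrt vs G ^\<^sub>m 2) $$ (i, i)) =
      (\<Sum>i<length vs. \<Sum>v\<in>pverts G. (randic_entry G (vs ! i) v)\<^sup>2)"
    by (intro sum.cong refl)
      (simp add: randic_mat_wrt_square_index[OF vs] power2_eq_square randic_entry_sym)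
  then show ?thesis
    unfolding eq sum_nth[OF vs(1), of "\<lambda>u. \<Sum>v\<in>pverts G. (randic_entry G u v)\<^sup>2"] vs(2) .
qed

text \<open>
  The trace of $R^4 = R^2 R^2$: since $R^2$ is symmetric as well, this is the sum of its squared
  entries.
\<close>

lemma sum_randic_spectrum_fourth:
  "(\<Sum>x\<in>#randic_spectrum G. x ^ 4) = (\<Sum>u\<in>pverts G. \<Sum>v\<in>pverts G.
    (\<Sum>w\<in>pverts G. randic_entry G u w * randic_entry G w v)\<^sup>2)"
    (is "_ = (\<Sum>u\<in>_. \<Sum>v\<in>_. (?q u v)\<^sup>2)")
proof (rule randic_spectrum_power_sum)
  fix vs assume vs: "distinct vs" "set vs = pverts G"
    and eq: "\<And>k. (\<Sum>x\<in>#randic_spectrum G. x ^ k) =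
      (\<Sum>i<length vs. (randic_mat_wrt vs G ^\<^sub>m k) $$ (i, i))"
  let ?R = "randic_mat_wrt vs G"
  have R: "?R \<in> carrier_mat (length vs) (length vs)" by (rule randic_mat_wrt_carrier)
  have R2: "?R ^\<^sub>m 2 \<in> carrier_mat (length vs) (length vs)" using R by simp
  have R4: "?R ^\<^sub>m 4 = ?R ^\<^sub>m 2 * ?R ^\<^sub>m 2"
    using R by (simp add: numeral_eq_Suc assoc_mult_mat[of _ "length vs" "length vs" _ "length vs" _ "length vs"])
  have q_sym: "?q u v = ?q v u" for u v
    by (intro sum.cong refl) (simp add: randic_entry_sym mult.commute)
  have "(?R ^\<^sub>m 4) $$ (i, i) = (\<Sum>v\<in>pverts G. (?q (vs ! i) v)\<^sup>2)" if i: "i < length vs" for i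
  proof -
    have "(?R ^\<^sub>m 4) $$ (i, i) = (\<Sum>j<length vs. (?R ^\<^sub>m 2) $$ (i, j) * (?R ^\<^sub>m 2) $$ (j, i))"
      unfolding R4 using i R R2 by (simp add: scalar_prod_def lessThan_atLeast0 del: pow_mat.simps)
    also have "\<dots> = (\<Sum>j<length vs. (?q (vs ! i) (vs ! j))\<^sup>2)"
      using i q_sym by (intro sum.cong refl) (simp add: randic_mat_wrt_square_index[OF vs] power2_eq_square)
    finally show ?thesis
      by (simp add: sum_nth[OF vs(1), of "\<lambda>v. (?q (vs ! i) v)\<^sup>2"] vs(2))
  qed
  then have "(\<Sum>i<length vs. (?R ^\<^sub>m 4) $$ (i, i)) = (\<Sum>i<length vs. \<Sum>v\<in>pverts G. (?q (vs ! i) v)\<^sup>2)"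
    by simp
  then show ?thesis
    unfolding eq sum_nth[OF vs(1), of "\<lambda>u. \<Sum>v\<in>pverts G. (?q u v)\<^sup>2"] vs(2) .
qed

text \<open>
  Eigenvectors as functions on the vertices; from here on no enumeration of the vertices is
  involved in statements about single eigenvalues.
\<close>

lemma in_randic_spectrum_iff:
  "x \<in># randic_spectrum G \<longleftrightarrow> (\<exists>f. (\<exists>v\<in>pverts G. f v \<noteq> 0) \<and>
    (\<forall>u\<in>pverts G. (\<Sum>v\<in>pverts G. randic_entry G u v * f v) = x * f u))"
proof -
  obtain vs where vs: "randic_mat G = randic_mat_wrt vs G" "distinct vs" "set vs = pverts G"
    by (rule randic_mat_obtain)
  let ?R = "randic_mat_wrt vs G" and ?n = "length vs"
  have R: "?R \<in> carrier_mat ?n ?n" by (rule randic_mat_wrt_carrier)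
  have nz: "char_poly ?R \<noteq> 0" using degree_monic_char_poly[OF R] by auto
  have mv: "?R *\<^sub>v vec ?n (\<lambda>i. f (vs ! i)) =
      vec ?n (\<lambda>i. \<Sum>v\<in>pverts G. randic_entry G (vs ! i) v * f v)" for f
    using sum_nth[OF vs(2), of "\<lambda>v. randic_entry G _ v * f v"]
    by (intro eq_vecI) (auto simp: randic_mat_wrt_def scalar_prod_def lessThan_atLeast0 vs(3))
  have all: "(\<forall>u\<in>pverts G. P u) \<longleftrightarrow> (\<forall>i<?n. P (vs ! i))" for P
    unfolding vs(3)[symmetric] all_set_conv_all_nth ..
  have key: "eigenvector ?R (vec ?n (\<lambda>i. f (vs ! i))) x \<longleftrightarrow> (\<exists>v\<in>pverts G. f v \<noteq> 0) \<and>
    (\<forall>u\<in>pverts G. (\<Sum>v\<in>pverts G. randic_entry G u v * f v) = x * f u)" for f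
    using all[of "\<lambda>v. f v = 0"] all[of "\<lambda>u. (\<Sum>v\<in>pverts G. randic_entry G u v * f v) = x * f u"] R
    unfolding eigenvector_def mv by (auto simp: vec_eq_iff)
  \<comment> \<open>every vector arises from a function on the vertices, since their enumeration is injective\<close>
  have "\<exists>f. w = vec ?n (\<lambda>i. f (vs ! i))" if "eigenvector ?R w x" for w
  proof -
    have "w = vec ?n (\<lambda>i. (w $ (THE k. k < ?n \<and> vs ! k = vs ! i)))"
    proof (rule eq_vecI)
      fix i assume i: "i < dim_vec (vec ?n (\<lambda>i. (w $ (THE k. k < ?n \<and> vs ! k = vs ! i))))"
      then have "(THE k. k < ?n \<and> vs ! k = vs ! i) = i"
        using vs(2) by (intro the_equality) (auto simp: nth_eq_iff_index_eq)
      with i show "w $ i = vec ?n (\<lambda>i. (w $ (THE k. k < ?n \<and> vs ! k = vs ! i))) $ i" by simp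
    qed (use that in \<open>auto simp: eigenvector_def randic_mat_wrt_def\<close>)
    then show ?thesis by (rule exI[of _ "\<lambda>v. w $ (THE k. k < ?n \<and> vs ! k = v)"])
  qed
  then have "eigenvalue ?R x \<longleftrightarrow> (\<exists>f. eigenvector ?R (vec ?n (\<lambda>i. f (vs ! i))) x)"
    unfolding eigenvalue_def by metis
  moreover have "x \<in># randic_spectrum G \<longleftrightarrow> eigenvalue ?R x"
    using nz by (simp add: randic_spectrum_def vs(1) eigenvalue_root_char_poly[OF R])
  ultimately show ?thesis by (simp add: key)
qed

text \<open>
  Changing the sign on one side of the bipartition conjugates $R$ into $-R$. Hence
  $\det R = \det(-R) = (-1)^n \det R$, which vanishes for odd $n$.
\<close>

lemma zero_in_randic_spectrum:
  assumes "bipartite G" and "odd (card (pverts G))"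
  shows "0 \<in># randic_spectrum G"
proof -
  obtain vs where vs: "randic_mat G = randic_mat_wrt vs G" "distinct vs" "set vs = pverts G"
      "length vs = card (pverts G)"
    by (rule randic_mat_obtain)
  let ?R = "randic_mat_wrt vs G" and ?n = "length vs"
  have R: "?R \<in> carrier_mat ?n ?n" by (rule randic_mat_wrt_carrier)
  obtain U W where UW: "U \<inter> W = {}" "parcs G \<subseteq> U \<times> W \<union> W \<times> U"
    using assms(1) unfolding bipartite_def by blast
  define s :: "'a \<Rightarrow> real" where "s v = (if v \<in> U then 1 else - 1)" for v
  have flip: "s u * randic_entry G u v * s v = - randic_entry G u v" for u v
    using UW by (auto simp: s_def randic_entry_def)
  define D where "D = mat ?n ?n (\<lambda>(i, j). if i = j then s (vs ! i) else 0)"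
  have D: "D \<in> carrier_mat ?n ?n" by (simp add: D_def)
  have DD: "D * D = 1\<^sub>m ?n"
  proof (rule eq_matI)
    fix i j assume "i < dim_row (1\<^sub>m ?n :: real mat)" and "j < dim_col (1\<^sub>m ?n :: real mat)"
    then have ij: "i < ?n" "j < ?n" by auto
    have "(D * D) $$ (i, j) = (\<Sum>k = 0..<?n. D $$ (i, k) * D $$ (k, j))"
      using ij D by (simp add: scalar_prod_def)
    also have "\<dots> = (\<Sum>k = 0..<?n. if k = i then (if i = j then (s (vs ! i))\<^sup>2 else 0) else 0)"
      using ij by (intro sum.cong refl) (auto simp: D_def power2_eq_square)
    finally show "(D * D) $$ (i, j) = 1\<^sub>m ?n $$ (i, j)"
      using ij by (simp add: s_def)
  qed (auto simp: D_def)
  have "D * ?R * D = (-1) \<cdot>\<^sub>m ?R"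
  proof (rule eq_matI)
    fix i j assume "i < dim_row ((-1) \<cdot>\<^sub>m ?R)" and "j < dim_col ((-1) \<cdot>\<^sub>m ?R)"
    then have ij: "i < ?n" "j < ?n" using R by auto
    have DR: "D * ?R \<in> carrier_mat ?n ?n" using D R by simp
    have 1: "(D * ?R) $$ (i, k) = s (vs ! i) * ?R $$ (i, k)" if "k < ?n" for k
      using ij that R by (simp add: D_def scalar_prod_def if_distrib if_distribR cong: if_cong)
    have 2: "D $$ (k, j) = (if k = j then s (vs ! j) else 0)" if "k < ?n" for k
      using ij that by (simp add: D_def)
    have "(D * ?R * D) $$ (i, j) = (\<Sum>k = 0..<?n. (D * ?R) $$ (i, k) * D $$ (k, j))"
      using ij D R DR by (simp add: scalar_prod_def del: assoc_mult_mat)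
    also have "\<dots> = (\<Sum>k = 0..<?n. if k = j then s (vs ! i) * ?R $$ (i, k) * s (vs ! j) else 0)"
      by (intro sum.cong refl) (simp add: 1 2 del: index_mult_mat(1))
    also have "\<dots> = ((-1) \<cdot>\<^sub>m ?R) $$ (i, j)"
      using ij R by (simp add: randic_mat_wrt_index flip)
    finally show "(D * ?R * D) $$ (i, j) = ((-1) \<cdot>\<^sub>m ?R) $$ (i, j)" .
  qed (use D R in auto)
  then have flip_det: "det D * det ?R * det D = (-1) ^ ?n * det ?R"
    using det_mult[of "D * ?R" ?n D] det_mult[OF D R] det_smult[of "-1" ?R] D R
    by (metis carrier_matD(2) mult_carrier_mat)
  have DD1: "det D * det D = 1"
    using det_mult[OF D D] DD by simp
  have "det ?R = (det D * det D) * det ?R" by (simp add: DD1)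
  also have "\<dots> = (-1) ^ ?n * det ?R" unfolding flip_det[symmetric] by simp
  also have "\<dots> = - det ?R" using assms(2) by (simp add: vs(4))
  finally have "det ?R = 0" by simp
  have "eigenvalue ?R 0"
  proof -
    have "char_matrix ?R 0 = ?R"
      using R unfolding char_matrix_def by (intro eq_matI) auto
    with \<open>det ?R = 0\<close> show ?thesis by (simp add: eigenvalue_det[OF R])
  qed
  moreover have "char_poly ?R \<noteq> 0" using degree_monic_char_poly[OF R] by auto
  ultimately show ?thesis
    by (simp add: randic_spectrum_def vs(1) eigenvalue_root_char_poly[OF R])
qed

end

section \<open>Upper bound for graphs without suspended paths\<close>

context pair_graph
begin

text \<open>
  The form in which connectedness is used: exhibiting a small set of vertices that no arc leaves
  bounds the order of the graph.
\<close>

lemma connected_closed_set: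
  assumes conn: "Digraph_Component.connected (with_proj G)"
    and x: "x \<in> A" "x \<in> pverts G"
    and closed: "\<And>u v. (u, v) \<in> parcs G \<Longrightarrow> u \<in> A \<Longrightarrow> v \<in> A"
  shows "pverts G \<subseteq> A"
proof
  fix y assume y: "y \<in> pverts G"
  have ends: "arcs_ends (with_proj G) = parcs G"
    by (auto simp: arcs_ends_def arc_to_ends_def)
  have "(x, y) \<in> rtrancl_on (pverts G) ((parcs G)\<^sup>s)"
    using conn x y by (simp add: connected_conv ends)
  then show "y \<in> A"
  proof (induction rule: rtrancl_on_induct)
    case (step u v)
    then have "(u, v) \<in> parcs G" using arc_sym by (auto simp: symcl_def)
    with step closed show ?case by blast
  qed (use x in simp)
qed

lemma connected_no_isolated:
  assumes "Digraph_Component.connected (with_proj G)" and "2 \<le> card (pverts G)" and u: "u \<in> pverts G"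
  shows "\<exists>v. (u, v) \<in> parcs G"
proof (rule ccontr)
  assume "\<not> ?thesis"
  then have "pverts G \<subseteq> {u}"
    using u by (intro connected_closed_set[OF assms(1)]) auto
  then have "card (pverts G) \<le> 1" using card_mono[of "{u}"] by simp
  with assms(2) show False by simp
qed

text \<open>
  An edge $uv$ with $d_u + d_v \le 3$ has a pendent end, say $u$. If also $d_v = 1$, then
  $\{u, v\}$ is a component, which is too small; if $d_v = 2$, then $u$, $v$ and the other
  neighbour of $v$ form a suspended path.
\<close>

lemma vdeg_sum_ge_4:
  assumes conn: "Digraph_Component.connected (with_proj G)" and n: "3 \<le> card (pverts G)"
    and nosusp: "\<not> (\<exists>u v w. suspended_path G u v w)"
    and uv: "(u, v) \<in> parcs G"
  shows "4 \<le> vdeg G u + vdeg G v"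
proof -
  have *: "3 \<le> vdeg G v" if uv: "(u, v) \<in> parcs G" and u: "vdeg G u = 1" for u v
  proof (rule ccontr)
    assume less: "\<not> 3 \<le> vdeg G v"
    have vu: "(v, u) \<in> parcs G" using uv arc_sym by blast
    obtain x where x: "{w. (u, w) \<in> parcs G} = {x}"
      using u unfolding vdeg_eq by (auto simp: card_1_singleton_iff)
    moreover have "v \<in> {w. (u, w) \<in> parcs G}" using uv by simp
    ultimately have Nu: "{w. (u, w) \<in> parcs G} = {v}" by simp
    have "\<exists>w. w \<noteq> u \<and> (v, w) \<in> parcs G"
    proof (rule ccontr)
      assume "\<nexists>w. w \<noteq> u \<and> (v, w) \<in> parcs G"
      then have "pverts G \<subseteq> {u, v}"
        using Nu in_arcsD1[OF uv] by (intro connected_closed_set[OF conn, of u]) auto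
      then have "card (pverts G) \<le> card {u, v}" by (intro card_mono) auto
      also have "\<dots> \<le> 2" by (simp add: card_insert_if)
      finally show False using n by simp
    qed
    then obtain w where w: "w \<noteq> u" "(v, w) \<in> parcs G" by blast
    have "card {u, w} \<le> vdeg G v"
      unfolding vdeg_eq using w vu by (intro card_mono finite_neighbours) auto
    then have "vdeg G v = 2" using w(1) less by simp
    moreover have "vpath [u, v, w] (with_proj G)"
      using w uv vu no_loops[OF uv] no_loops[OF w(2)] in_arcsD1[OF uv] in_arcsD2[OF uv] in_arcsD2[OF w(2)]
      by (auto simp: vpath_def vwalk_def arcs_ends_def arc_to_ends_def)
    ultimately show False using u nosusp unfolding suspended_path_def by blast
  qed
  have vu: "(v, u) \<in> parcs G" using uv arc_sym by blast
  show ?thesis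
    using *[OF uv] *[OF vu] vdeg_pos[OF uv] vdeg_pos[OF vu] by linarith
qed

text \<open>
  For an edge, $d_u + d_v \ge 4$ says exactly that
  $\frac{1}{d_u d_v} \le \frac{1}{4 d_u} + \frac{1}{4 d_v}$. Summed over all arcs, each vertex
  receives $\frac14$ from its outgoing and $\frac14$ from its incoming arcs.
\<close>

lemma sum_square_randic_entry_le:
  assumes no_isol: "\<And>u. u \<in> pverts G \<Longrightarrow> \<exists>v. (u, v) \<in> parcs G"
    and deg: "\<And>u v. (u, v) \<in> parcs G \<Longrightarrow> 4 \<le> vdeg G u + vdeg G v"
  shows "(\<Sum>u\<in>pverts G. \<Sum>v\<in>pverts G. (randic_entry G u v)\<^sup>2) \<le> real (card (pverts G)) / 2"
proof -
  define g where "g u v = (if (u, v) \<in> parcs G then 1 / (4 * real (vdeg G u)) else 0)" for u v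
  have bound: "(randic_entry G u v)\<^sup>2 \<le> g u v + g v u" for u v
  proof (cases "(u, v) \<in> parcs G")
    case True
    then have vu: "(v, u) \<in> parcs G" using arc_sym by blast
    define a b where "a = real (vdeg G u)" and "b = real (vdeg G v)"
    have ab: "0 < a" "0 < b" "4 \<le> a + b"
      using vdeg_pos[OF True] vdeg_pos[OF vu] deg[OF True] unfolding a_def b_def by linarith+
    have "(randic_entry G u v)\<^sup>2 = 1 / (a * b)"
      using True ab by (simp add: randic_entry_def a_def b_def power_divide)
    also have "\<dots> \<le> (a + b) / (4 * (a * b))"
      using ab by (simp add: divide_simps)
    also have "\<dots> = g u v + g v u"
      using True vu ab by (simp add: g_def a_def[symmetric] b_def[symmetric] field_simps)
    finally show ?thesis .
  qed (simp add: g_def randic_entry_def arc_sym[of v u])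
  have row: "(\<Sum>v\<in>pverts G. g u v) = 1 / 4" if "u \<in> pverts G" for u
  proof -
    obtain v where "(u, v) \<in> parcs G" using no_isol[OF \<open>u \<in> pverts G\<close>] by blast
    then have "0 < vdeg G u" by (rule vdeg_pos)
    then show ?thesis by (simp add: g_def sum_neighbours vdeg_eq[symmetric])
  qed
  have "(\<Sum>u\<in>pverts G. \<Sum>v\<in>pverts G. (randic_entry G u v)\<^sup>2)
      \<le> (\<Sum>u\<in>pverts G. \<Sum>v\<in>pverts G. g u v + g v u)"
    by (intro sum_mono bound)
  also have "\<dots> = (\<Sum>u\<in>pverts G. \<Sum>v\<in>pverts G. g u v) + (\<Sum>u\<in>pverts G. \<Sum>v\<in>pverts G. g u v)"
    unfolding sum.distrib by (subst (3) sum.swap) simp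
  also have "\<dots> = real (card (pverts G)) / 2"
    by (simp add: row)
  finally show ?thesis .
qed

text \<open>
  The vector $(\sqrt{d_v})_v$ is an eigenvector for $1$; changing its sign on one side of the
  bipartition gives an eigenvector for $-1$.
\<close>

lemma one_in_randic_spectrum:
  assumes ne: "pverts G \<noteq> {}" and no_isol: "\<And>u. u \<in> pverts G \<Longrightarrow> \<exists>v. (u, v) \<in> parcs G"
  shows "1 \<in># randic_spectrum G" and "bipartite G \<Longrightarrow> - 1 \<in># randic_spectrum G"
proof -
  have pos: "0 < vdeg G u" if "u \<in> pverts G" for u
    using no_isol[OF that] vdeg_pos by blast
  have row: "(\<Sum>v\<in>pverts G. randic_entry G u v * sqrt (real (vdeg G v))) = sqrt (real (vdeg G u))"
    if u: "u \<in> pverts G" for u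
  proof -
    have "(\<Sum>v\<in>pverts G. randic_entry G u v * sqrt (real (vdeg G v))) =
        (\<Sum>v\<in>pverts G. if (u, v) \<in> parcs G then 1 / sqrt (real (vdeg G u)) else 0)"
      using pos by (intro sum.cong refl) (simp add: randic_entry_def real_sqrt_mult)
    also have "\<dots> = real (vdeg G u) / sqrt (real (vdeg G u))"
      by (simp add: sum_neighbours vdeg_eq)
    finally show ?thesis by (simp add: real_div_sqrt)
  qed
  obtain u where u: "u \<in> pverts G" using ne by blast
  show "1 \<in># randic_spectrum G"
    unfolding in_randic_spectrum_iff using row pos[OF u] u
    by (intro exI[of _ "\<lambda>v. sqrt (real (vdeg G v))"]) auto
  assume "bipartite G"
  then obtain U W where UW: "U \<inter> W = {}" "parcs G \<subseteq> U \<times> W \<union> W \<times> U"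
    unfolding bipartite_def by blast
  define s :: "'a \<Rightarrow> real" where "s v = (if v \<in> U then 1 else - 1)" for v
  have flip: "randic_entry G u v * (s v * x) = - s u * (randic_entry G u v * x)" for u v x
    using UW by (auto simp: s_def randic_entry_def)
  have "(\<Sum>v\<in>pverts G. randic_entry G u v * (s v * sqrt (real (vdeg G v)))) =
      - 1 * (s u * sqrt (real (vdeg G u)))" if "u \<in> pverts G" for u
    unfolding flip sum_distrib_left[symmetric] row[OF that] by simp
  then show "- 1 \<in># randic_spectrum G"
    unfolding in_randic_spectrum_iff using pos[OF u] u
    by (intro exI[of _ "\<lambda>v. s v * sqrt (real (vdeg G v))"]) (auto simp: s_def)
qed

end

text \<open>
  This replaces the Cauchy--Schwarz inequality below. Equality holds at $|x| = 1/\sqrt 2$, the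
  value of all eigenvalues of the sun other than $0$ and $\pm 1$.
\<close>

lemma abs_le_tangent: "\<bar>x\<bar> \<le> (x\<^sup>2 + 1 / 2) / sqrt (2 :: real)"
proof -
  have "0 \<le> (\<bar>x\<bar> - 1 / sqrt 2)\<^sup>2" by simp
  also have "\<dots> = x\<^sup>2 + 1 / 2 - sqrt 2 * \<bar>x\<bar>"
    by (simp add: power2_diff power_divide real_div_sqrt field_simps)
  finally show ?thesis by (simp add: field_simps)
qed

text \<open>
  The eigenvalues $1$, $-1$, $0$ account for $2$ in the energy and for $2$ in the sum of squares.
  The other $2p - 2$ eigenvalues then have squares summing to at most $p - 1$, that is $\frac12$
  on average.
\<close>

lemma randic_energy_le:
  assumes "pair_graph G" and "Digraph_Component.connected (with_proj G)" and "bipartite G"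
    and n: "card (pverts G) = 2 * p + 1" and p: "1 \<le> p"
    and sq: "(\<Sum>u\<in>pverts G. \<Sum>v\<in>pverts G. (randic_entry G u v)\<^sup>2) \<le> real p + 1"
  shows "randic_energy G \<le> 2 + sqrt 2 * (real p - 1)"
proof -
  interpret pair_graph G by fact
  have ne: "pverts G \<noteq> {}" using n by auto
  have no_isol: "\<exists>v. (u, v) \<in> parcs G" if "u \<in> pverts G" for u
    using connected_no_isolated[OF assms(2) _ that] n p by simp
  have "mset_set {1, - 1, 0} \<subseteq># randic_spectrum G"
    using one_in_randic_spectrum[OF ne no_isol] zero_in_randic_spectrum \<open>bipartite G\<close> n
    by (intro subset_imp_msubset_mset_set[THEN subset_mset.trans[OF _ mset_set_set_mset_msubset]]) auto
  then obtain M where "randic_spectrum G = mset_set {1, - 1, 0} + M"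
    by (auto simp: subset_mset.le_iff_add)
  then have M: "randic_spectrum G = {#1, - 1, 0#} + M" by simp
  have size: "real (size M) = 2 * real p - 2"
    using size_randic_spectrum n p unfolding M by simp
  define S where "S = (\<Sum>x\<in>#M. x\<^sup>2)"
  have S: "S \<le> real p - 1"
    using sum_randic_spectrum_square sq unfolding M S_def by simp
  have "(\<Sum>x\<in>#M. \<bar>x\<bar>) \<le> (\<Sum>x\<in>#M. (x\<^sup>2 + 1 / 2) / sqrt 2)"
    by (intro sum_mset_mono abs_le_tangent)
  also have "\<dots> = (S + real (size M) / 2) / sqrt 2"
    unfolding S_def by (induction M) (simp_all add: field_simps)
  also have "\<dots> \<le> (2 * (real p - 1)) / sqrt 2"
  proof (intro divide_right_mono)
    show "S + real (size M) / 2 \<le> 2 * (real p - 1)"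
      using S size by (simp add: field_simps)
  qed simp
  also have "\<dots> = sqrt 2 * (real p - 1)"
    by (simp add: field_simps)
  finally show ?thesis
    unfolding randic_energy_spectrum M by simp
qed

section \<open>The energy of the sun\<close>

text \<open>
  The vertices of the sun are the centre \<^term>\<open>Inl 0\<close>, the pendent vertices
  \<^term>\<open>Inl i\<close> and the middle vertices \<^term>\<open>Inr {0, i}\<close> for $1 \le i \le p$.
\<close>

lemma sun_arcs:
  "(x, y) \<in> parcs (sun p) \<longleftrightarrow> (\<exists>i\<in>{1..p}.
    x = Inl 0 \<and> y = Inr {0, i} \<or> x = Inr {0, i} \<and> y = Inl 0 \<or>
    x = Inl i \<and> y = Inr {0, i} \<or> x = Inr {0, i} \<and> y = Inl i)"
  unfolding sun_def subdivide_edges_def star_graph_def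
  by (fastforce simp: insert_commute)

lemma sun_verts:
  "pverts (sun p) = insert (Inl 0) (Inl ` {1..p} \<union> (\<lambda>i. Inr {0, i}) ` {1..p})"
proof -
  have "{{u, v} | u v. (u, v) \<in> parcs (star_graph p)} = (\<lambda>i. {0, i}) ` {1..p}"
    unfolding star_graph_def by (fastforce simp: insert_commute)
  moreover have "{0..p} = insert 0 {1..p}" by auto
  ultimately show ?thesis
    unfolding sun_def subdivide_edges_def by (auto simp: star_graph_def Plus_def)
qed

lemma mid_eq_iff: "{0, i} = {0, j} \<longleftrightarrow> i = (j :: nat)"
  by (auto simp: doubleton_eq_iff)

lemma sum_sun_verts:
  fixes h :: "nat + nat set \<Rightarrow> real"
  shows "sum h (pverts (sun p)) = h (Inl 0) + (\<Sum>i=1..p. h (Inl i)) + (\<Sum>i=1..p. h (Inr {0, i}))"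
proof -
  have "sum h (pverts (sun p)) =
      h (Inl 0) + (sum h (Inl ` {1..p}) + sum h ((\<lambda>i. Inr {0, i}) ` {1..p}))"
    unfolding sun_verts by (subst sum.insert) (auto intro!: sum.union_disjoint)
  then show ?thesis
    by (simp add: sum.reindex inj_on_def mid_eq_iff)
qed

lemma vdeg_sun:
  "vdeg (sun p) (Inl 0) = p"
  "1 \<le> i \<Longrightarrow> i \<le> p \<Longrightarrow> vdeg (sun p) (Inl i) = 1"
  "1 \<le> i \<Longrightarrow> i \<le> p \<Longrightarrow> vdeg (sun p) (Inr {0, i}) = 2"
proof -
  interpret pair_graph "sun p" by (rule pair_graph_sun)
  have "{y. (Inl 0, y) \<in> parcs (sun p)} = (\<lambda>i. Inr {0, i}) ` {1..p}"
    by (auto simp: sun_arcs)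
  then show "vdeg (sun p) (Inl 0) = p"
    by (simp add: vdeg_eq card_image inj_on_def mid_eq_iff)
  assume i: "1 \<le> i" "i \<le> p"
  then have "{y. (Inl i, y) \<in> parcs (sun p)} = {Inr {0, i}}"
    by (auto simp: sun_arcs)
  then show "vdeg (sun p) (Inl i) = 1" by (simp add: vdeg_eq)
  from i have "{y. (Inr {0, i}, y) \<in> parcs (sun p)} = {Inl 0, Inl i}"
    by (auto simp: sun_arcs mid_eq_iff)
  with i show "vdeg (sun p) (Inr {0, i}) = 2" by (simp add: vdeg_eq)
qed

lemma randic_entry_sun:
  "randic_entry (sun p) (Inl i) (Inl j) = 0"
  "randic_entry (sun p) (Inr {0, i}) (Inr {0, j}) = 0"
  "1 \<le> i \<Longrightarrow> i \<le> p \<Longrightarrow> randic_entry (sun p) (Inl 0) (Inr {0, i}) = 1 / sqrt (2 * real p)"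
  "1 \<le> i \<Longrightarrow> i \<le> p \<Longrightarrow> randic_entry (sun p) (Inr {0, i}) (Inl 0) = 1 / sqrt (2 * real p)"
  "1 \<le> i \<Longrightarrow> i \<le> p \<Longrightarrow> 1 \<le> j \<Longrightarrow> j \<le> p \<Longrightarrow>
    randic_entry (sun p) (Inl i) (Inr {0, j}) = (if j = i then 1 / sqrt 2 else 0)"
  "1 \<le> i \<Longrightarrow> i \<le> p \<Longrightarrow> 1 \<le> j \<Longrightarrow> j \<le> p \<Longrightarrow>
    randic_entry (sun p) (Inr {0, i}) (Inl j) = (if j = i then 1 / sqrt 2 else 0)"
  by (auto simp: randic_entry_def sun_arcs vdeg_sun mid_eq_iff mult.commute)

lemma randic_sun_apply:
  "(\<Sum>v\<in>pverts (sun p). randic_entry (sun p) (Inl 0) v * f v) =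
    (\<Sum>i=1..p. f (Inr {0, i})) / sqrt (2 * real p)"
  "1 \<le> i \<Longrightarrow> i \<le> p \<Longrightarrow>
    (\<Sum>v\<in>pverts (sun p). randic_entry (sun p) (Inl i) v * f v) = f (Inr {0, i}) / sqrt 2"
  "1 \<le> i \<Longrightarrow> i \<le> p \<Longrightarrow>
    (\<Sum>v\<in>pverts (sun p). randic_entry (sun p) (Inr {0, i}) v * f v) =
      f (Inl 0) / sqrt (2 * real p) + f (Inl i) / sqrt 2"
  by (simp_all add: sum_sun_verts randic_entry_sun sum_divide_distrib if_distribR if_distrib cong: if_cong)

lemma sum_square_randic_entry_sun:
  assumes "1 \<le> p"
  shows "(\<Sum>u\<in>pverts (sun p). \<Sum>v\<in>pverts (sun p). (randic_entry (sun p) u v)\<^sup>2) = real p + 1"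
proof -
  let ?h = "\<lambda>u. \<Sum>v\<in>pverts (sun p). randic_entry (sun p) u v * randic_entry (sun p) u v"
  show ?thesis
    unfolding power2_eq_square sum_sun_verts[where h = ?h] using assms
    by (simp add: randic_sun_apply randic_entry_sun) (simp add: field_simps)
qed

text \<open>
  The nonzero entries of $R^2$ join vertices at distance $0$ or $2$: the centre with itself and with
  the pendent vertices, each pendent vertex with itself, and the middle vertices with each other.
\<close>

lemma sum_square_square_randic_entry_sun:
  assumes p: "1 \<le> p"
  shows "(\<Sum>u\<in>pverts (sun p). \<Sum>v\<in>pverts (sun p).
    (\<Sum>w\<in>pverts (sun p). randic_entry (sun p) u w * randic_entry (sun p) w v)\<^sup>2) = (real p + 3) / 2"
    (is "(\<Sum>u\<in>?V. \<Sum>v\<in>?V. (?q u v)\<^sup>2) = _")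
proof -
  have s: "sqrt (2 * real p) * sqrt (2 * real p) = 2 * real p" "sqrt 2 * sqrt 2 = (2 :: real)"
    by simp_all
  have q:
    "?q (Inl 0) (Inl 0) = 1 / 2"
    "1 \<le> i \<Longrightarrow> i \<le> p \<Longrightarrow> ?q (Inl 0) (Inl i) = 1 / (sqrt 2 * sqrt (2 * real p))"
    "1 \<le> i \<Longrightarrow> i \<le> p \<Longrightarrow> ?q (Inl i) (Inl 0) = 1 / (sqrt 2 * sqrt (2 * real p))"
    "1 \<le> i \<Longrightarrow> i \<le> p \<Longrightarrow> ?q (Inl 0) (Inr {0, i}) = 0"
    "1 \<le> i \<Longrightarrow> i \<le> p \<Longrightarrow> ?q (Inr {0, i}) (Inl 0) = 0"
    "1 \<le> i \<Longrightarrow> i \<le> p \<Longrightarrow> 1 \<le> j \<Longrightarrow> j \<le> p \<Longrightarrow> ?q (Inl i) (Inl j) = (if j = i then 1 / 2 else 0)"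
    "1 \<le> i \<Longrightarrow> i \<le> p \<Longrightarrow> 1 \<le> j \<Longrightarrow> j \<le> p \<Longrightarrow> ?q (Inl i) (Inr {0, j}) = 0"
    "1 \<le> i \<Longrightarrow> i \<le> p \<Longrightarrow> 1 \<le> j \<Longrightarrow> j \<le> p \<Longrightarrow> ?q (Inr {0, i}) (Inl j) = 0"
    "1 \<le> i \<Longrightarrow> i \<le> p \<Longrightarrow> 1 \<le> j \<Longrightarrow> j \<le> p \<Longrightarrow> ?q (Inr {0, i}) (Inr {0, j}) =
      1 / (2 * real p) + (if j = i then 1 / 2 else 0)" for i j
    using p by (auto simp: randic_sun_apply randic_entry_sun s)
  have sq: "(1 / (sqrt 2 * sqrt (2 * real p)))\<^sup>2 = 1 / (4 * real p)"
    by (simp add: power_divide power_mult_distrib)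
  have center: "(\<Sum>v\<in>?V. (?q (Inl 0) v)\<^sup>2) = 1 / 2"
    unfolding sum_sun_verts[where h = "\<lambda>v. (?q (Inl 0) v)\<^sup>2"] using p
    by (simp add: q sq) (simp add: power2_eq_square)
  have leaf: "(\<Sum>v\<in>?V. (?q (Inl i) v)\<^sup>2) = 1 / (4 * real p) + 1 / 4" if "1 \<le> i" "i \<le> p" for i
    unfolding sum_sun_verts[where h = "\<lambda>v. (?q (Inl i) v)\<^sup>2"] using that
    by (simp add: q sq if_distrib[of "\<lambda>x. x\<^sup>2"] power_divide[of _ 2] cong: if_cong)
  have mid: "(\<Sum>v\<in>?V. (?q (Inr {0, i}) v)\<^sup>2) = 3 / (4 * real p) + 1 / 4" if i: "1 \<le> i" "i \<le> p" for i
  proof -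
    have "(\<Sum>v\<in>?V. (?q (Inr {0, i}) v)\<^sup>2) =
        (\<Sum>j=1..p. (1 / (2 * real p) + (if j = i then 1 / 2 else 0))\<^sup>2)"
      unfolding sum_sun_verts[where h = "\<lambda>v. (?q (Inr {0, i}) v)\<^sup>2"] using i by (simp add: q)
    also have "\<dots> = (\<Sum>j=1..p. 1 / (4 * (real p)\<^sup>2) + (if j = i then 1 / (2 * real p) + 1 / 4 else 0))"
      by (intro sum.cong refl) (simp add: power2_eq_square field_simps)
    also have "\<dots> = 3 / (4 * real p) + 1 / 4"
      using i p by (simp add: sum.distrib power2_eq_square)
    finally show ?thesis .
  qed
  show ?thesis
    unfolding sum_sun_verts[where h = "\<lambda>u. \<Sum>v\<in>?V. (?q u v)\<^sup>2"] using p
    by (simp add: center leaf mid) (simp add: field_simps)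
qed

text \<open>
  Eliminating the pendent coordinates from $Rf = xf$, $x \ne 0$, gives
  $(x^2 - \frac12) f(m) = x f(c) / \sqrt{2p}$ at every middle vertex $m$, where $c$ is the centre.
  If $x^2 \neq \frac12$, all values $f(m)$ are thus determined by $f(c)$, and the equation at the
  centre forces $x^2 = 1$ or $f = 0$.
\<close>

lemma randic_spectrum_sun:
  assumes p: "1 \<le> p" and x: "x \<in># randic_spectrum (sun p)"
  shows "x = 0 \<or> x\<^sup>2 = 1 \<or> x\<^sup>2 = 1 / 2"
proof (rule ccontr)
  interpret pair_graph "sun p" by (rule pair_graph_sun)
  assume neg: "\<not> ?thesis"
  obtain f where nz: "\<exists>v\<in>pverts (sun p). f v \<noteq> 0"
    and ev: "\<And>u. u \<in> pverts (sun p) \<Longrightarrow>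
      (\<Sum>v\<in>pverts (sun p). randic_entry (sun p) u v * f v) = x * f u"
    using x unfolding in_randic_spectrum_iff by blast
  let ?a = "sqrt (2 * real p)"
  have V: "Inl 0 \<in> pverts (sun p)"
    "i \<in> {1..p} \<Longrightarrow> Inl i \<in> pverts (sun p)" "i \<in> {1..p} \<Longrightarrow> Inr {0, i} \<in> pverts (sun p)" for i
    by (simp_all add: sun_verts)
  have center: "(\<Sum>i=1..p. f (Inr {0, i})) / ?a = x * f (Inl 0)"
    using ev[OF V(1)] by (simp add: randic_sun_apply)
  have leaf: "f (Inr {0, i}) / sqrt 2 = x * f (Inl i)" if "i \<in> {1..p}" for i
    using ev[OF V(2)[OF that]] that by (simp add: randic_sun_apply)
  have mid: "f (Inl 0) / ?a + f (Inl i) / sqrt 2 = x * f (Inr {0, i})" if "i \<in> {1..p}" for i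
    using ev[OF V(3)[OF that]] that by (simp add: randic_sun_apply)
  have m: "(x\<^sup>2 - 1 / 2) * f (Inr {0, i}) = x * f (Inl 0) / ?a" if i: "i \<in> {1..p}" for i
  proof -
    have "x\<^sup>2 * f (Inr {0, i}) = x * (f (Inl 0) / ?a + f (Inl i) / sqrt 2)"
      using mid[OF i] by (simp add: power2_eq_square)
    also have "\<dots> = x * f (Inl 0) / ?a + (x * f (Inl i)) / sqrt 2"
      by (simp add: field_simps)
    also have "(x * f (Inl i)) / sqrt 2 = f (Inr {0, i}) / 2"
      unfolding leaf[OF i, symmetric] by simp
    finally show ?thesis by (simp add: algebra_simps)
  qed
  have "(x\<^sup>2 - 1 / 2) * (x * f (Inl 0)) = (\<Sum>i=1..p. (x\<^sup>2 - 1 / 2) * f (Inr {0, i})) / ?a"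
    unfolding center[symmetric] by (simp add: sum_distrib_left)
  also have "\<dots> = x * f (Inl 0) / 2"
    using p by (simp add: m)
  finally have "(x\<^sup>2 - 1) * (x * f (Inl 0)) = 0"
    by (simp add: algebra_simps)
  then have c: "f (Inl 0) = 0" using neg by auto
  have "f (Inr {0, i}) = 0" if "i \<in> {1..p}" for i
    using m[OF that] c neg by auto
  moreover from this have "f (Inl i) = 0" if "i \<in> {1..p}" for i
    using leaf[OF that] that neg by auto
  ultimately show False using nz c by (auto simp: sun_verts)
qed

text \<open>
  On the three possible values of $|x|$ the absolute value agrees with an even polynomial of degree
  $4$ without constant term. The energy is therefore a combination of the traces of $R^2$ and $R^4$,
  and no multiplicities have to be computed.
\<close>

lemma randic_energy_sun:
  assumes p: "1 \<le> p"
  shows "randic_energy (sun p) = 2 + sqrt 2 * (real p - 1)"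
proof -
  interpret pair_graph "sun p" by (rule pair_graph_sun)
  \<comment> \<open>the coefficients solve $a + b = 1$ and $\frac a2 + \frac b4 = \frac{1}{\sqrt 2}$\<close>
  let ?a = "2 * sqrt 2 - 1 :: real" and ?b = "2 - 2 * sqrt 2 :: real"
  have "\<bar>x\<bar> = ?a * x\<^sup>2 + ?b * x ^ 4" if x: "x \<in># randic_spectrum (sun p)" for x
  proof -
    have pow4: "x ^ 4 = (x\<^sup>2)\<^sup>2" by simp
    have abs: "\<bar>x\<bar> = sqrt (x\<^sup>2)" by simp
    consider "x = 0" | "x\<^sup>2 = 1" | "x\<^sup>2 = 1 / 2"
      using randic_spectrum_sun[OF p x] by blast
    then show ?thesis
    proof cases
      case 2
      then show ?thesis unfolding pow4 abs by simp
    next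
      case 3
      then show ?thesis unfolding pow4 abs 3
        by (simp add: power2_eq_square real_sqrt_divide field_simps)
    qed simp
  qed
  then have "randic_energy (sun p) = (\<Sum>x\<in>#randic_spectrum (sun p). ?a * x\<^sup>2 + ?b * x ^ 4)"
    unfolding randic_energy_spectrum by (intro arg_cong[of _ _ sum_mset] image_mset_cong) auto
  also have "\<dots> = ?a * (\<Sum>x\<in>#randic_spectrum (sun p). x\<^sup>2) + ?b * (\<Sum>x\<in>#randic_spectrum (sun p). x ^ 4)"
    by (simp add: sum_mset.distrib sum_mset_distrib_left image_mset.compositionality o_def)
  also have "\<dots> = ?a * (real p + 1) + ?b * ((real p + 3) / 2)"
    unfolding sum_randic_spectrum_square sum_randic_spectrum_fourth
      sum_square_randic_entry_sun[OF p] sum_square_square_randic_entry_sun[OF p] ..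
  also have "\<dots> = 2 + sqrt 2 * (real p - 1)"
    by (simp add: field_simps)
  finally show ?thesis .
qed

section \<open>Extremality of the sun\<close>

theorem mainTheorem11:
  fixes G :: "'a pair_pre_digraph" and n p :: nat
  assumes "n = 2 * p + 1" and "n \<ge> 3"
    and "pair_graph G"
    and "card (pverts G) = n"
    and "Digraph_Component.connected (with_proj G)"
    and "bipartite G"
    and "\<not> (\<exists>u v w. suspended_path G u v w)"
  shows "randic_energy G \<le> randic_energy (sun p)"
proof -
  interpret pair_graph G by fact
  have p: "1 \<le> p" and n: "card (pverts G) = 2 * p + 1" using assms(1,2,4) by auto
  have "(\<Sum>u\<in>pverts G. \<Sum>v\<in>pverts G. (randic_entry G u v)\<^sup>2) \<le> real (card (pverts G)) / 2"
  proof (rule sum_square_randic_entry_le)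
    show "\<exists>v. (u, v) \<in> parcs G" if "u \<in> pverts G" for u
      using connected_no_isolated[OF assms(5) _ that] n p by simp
    show "4 \<le> vdeg G u + vdeg G v" if "(u, v) \<in> parcs G" for u v
      using vdeg_sum_ge_4[OF assms(5) _ assms(7) that] n p by simp
  qed
  also have "\<dots> \<le> real p + 1"
    by (simp add: n field_simps)
  finally show ?thesis
    unfolding randic_energy_sun[OF p]
    by (rule randic_energy_le[OF assms(3,5,6) n p])
qed

end
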